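(* Let $F:\mathbb{BC}^n\to\mathbb{BC}$ be a bicomplex polar weighted homogeneous polynomial and let $V_F=F^{-1}(\mathfrak{S})$. Then the map $F:\mathbb{BC}^n\setminus V_F\to\mathbb{BC}^*$ is a locally trivial fibration.
   Context: Bicomplex numbers: $\mathbb{BC}=\{\lambda_1+\mathbf{j}\lambda_2:\lambda_1,\lambda_2\in\mathbb{C}\}$, where $\mathbb{C}=\mathbb{C}(\mathbf{i})$, $\mathbf{i}^2=\mathbf{j}^2=-1$, $\mathbf{i}\neq\mathbf{j}$, $\mathbf{i}\mathbf{j}=\mathbf{j}\mathbf{i}$; as a real vector space $\mathbb{BC}\simeq\mathbb{R}^4$. With $\mathbf{e}=(1+\mathbf{i}\mathbf{j})/2$ and $\mathbf{e}^\dagger=(1-\mathbf{i}\mathbf{j})/2$, every $Z=\lambda_1+\mathbf{j}\lambda_2$ is uniquely $Z=z_1\mathbf{e}+z_2\mathbf{e}^\dagger$ with $z_1=\lambda_1-\mathbf{i}\lambda_2$, $z_2=\lambda_1+\mathbf{i}\lambda_2\in\mathbb{C}$; $\mathbb{BC}^*=\{z_1\mathbf{e}+z_2\mathbf{e}^\dagger: z_1,z_2\ne0\}$ is the set of invertible elements and $\mathfrak{S}=\mathbb{BC}\setminus\mathbb{BC}^*$. Conjugations: $\widetilde Z=\bar\lambda_1-\mathbf{j}\bar\lambda_2$, $\widehat Z=\lambda_1-\mathbf{j}\lambda_2$, $\overline Z=\bar\lambda_1+\mathbf{j}\bar\lambda_2$ (applied componentwise on $\mathbb{BC}^n$). A bicomplex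 mixed polynomial is a function $\mathbb{BC}^n\to\mathbb{BC}$ that is a finite sum of terms $\lambda\prod_{i=1}^n Z_i^{a_i}\widetilde Z_i^{b_i}\widehat Z_i^{c_i}\overline Z_i^{d_i}$ with $\lambda\in\mathbb{BC}\setminus\{0\}$ and non-negative integer exponents. The complex unit circle is $\mathbb{S}^1_{\mathbb{C}}=\{(z,w)\in\mathbb{C}^2:z^2+w^2=1\}$, identified with $\{z+\mathbf{j}w\}\subset\mathbb{BC}$; its elements are written $e^{\mathbf{j}\Theta}=\cos\Theta+\mathbf{j}\sin\Theta$ with $\Theta\in\mathbb{C}$. Polar action: let $t_j,p_j,u_j$ ($j=1,\dots,n$) be positive integers with $\gcd(p_1,\dots,p_n)=\gcd(u_1,\dots,u_n)=\gcd(t_1,\dots,t_n)=1$. For $\Lambda=se^{\mathbf{i}\theta}e^{\mathbf{j}\Theta}\in\mathbb{BC}^*$ with $s\in\mathbb{R}^+$, $e^{\mathbf{i}\theta}\in\mathbb{S}^1$, $e^{\mathbf{j}\Theta}\in\mathbb{S}^1_{\mathbb{C}}$, the action with radial weights $(t_j)$, polar weights $(p_j)$ and complex polar weights $(u_j)$ is $\Lambda\cdot Z=(s^{t_j}e^{\mathbf{i}p_j\theta}e^{\mathbf{j}u_j\Theta}Z_j)_j$, $\Lambda\cdot\widehat Z=(s^{t_j}e^{\mathbf{i}p_j\theta}e^{-\mathbf{j}u_j\Theta}\widehat Z_j)_j$, $\Lambda\cdot\widetilde Z=(s^{t_j}e^{-\mathbf{i}p_j\theta}e^{-\mathbf{j}u_j\overline\Theta}\widetilde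 Z_j)_j$, $\Lambda\cdot\overline Z=(s^{t_j}e^{-\mathbf{i}p_j\theta}e^{\mathbf{j}u_j\overline\Theta}\overline Z_j)_j$. A bicomplex mixed polynomial $F$ is polar weighted homogeneous if there are such weights and non-negative integers $a,c,d,d'$ with $a,c>0$ and ($d>0$ or $d'>0$) such that $F(se^{\mathbf{i}\theta}e^{\mathbf{j}\Theta}\cdot(Z,\widetilde Z,\widehat Z,\overline Z))=s^a e^{\mathbf{i}c\theta}e^{\mathbf{j}d\Theta}e^{\mathbf{j}d'\overline\Theta}F(Z,\widetilde Z,\widehat Z,\overline Z)$ for all $s\in\mathbb{R}^+$, $e^{\mathbf{i}\theta}\in\mathbb{S}^1$, $e^{\mathbf{j}\Theta}\in\mathbb{S}^1_{\mathbb{C}}$.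
   Formalization: The formal theorem additionally assumes d ≠ d' for the degrees of F; without it the claim fails, e.g. for n=1, F(Z)=Z²·Ẑ·Z̄ (a=4, c=2, d=d'=1), whose values z₁e+z₂e† all satisfy |z₁|=|z₂|, so its image in BC* is not open. *)

theory Defs
  imports "HOL-Analysis.Analysis"
begin

section \<open>Bicomplex numbers\<close>

text \<open>\<open>BiComplex \<lambda>\<^sub>1 \<lambda>\<^sub>2\<close> is the bicomplex number \<open>\<lambda>\<^sub>1 + \<^bold>j \<lambda>\<^sub>2\<close>, where the imaginary unit \<open>\<^bold>i\<close> is
  the \<^term>\<open>\<i>\<close> of type \<^typ>\<open>complex\<close>.\<close>

datatype bicomplex = BiComplex (fst_part: complex) (snd_part: complex)

lemma bicomplex_eqI:
  "fst_part Z = fst_part W \<Longrightarrow> snd_part Z = snd_part W \<Longrightarrow> Z = W"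
  by (cases Z; cases W) simp

instantiation bicomplex :: comm_ring_1
begin

definition "0 = BiComplex 0 0"
definition "1 = BiComplex 1 0"
definition "Z + W = BiComplex (fst_part Z + fst_part W) (snd_part Z + snd_part W)"
definition "Z - W = BiComplex (fst_part Z - fst_part W) (snd_part Z - snd_part W)"
definition "- Z = BiComplex (- fst_part Z) (- snd_part Z)"
definition "Z * W = BiComplex (fst_part Z * fst_part W - snd_part Z * snd_part W)
                              (fst_part Z * snd_part W + snd_part Z * fst_part W)"

instance
  by intro_classes
    (simp_all add: zero_bicomplex_def one_bicomplex_def plus_bicomplex_def minus_bicomplex_def
      uminus_bicomplex_def times_bicomplex_def algebra_simps)

end

text \<open>The norm is the Euclidean norm of \<open>\<real>\<^sup>4\<close>. It is not submultiplicative for the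
  bicomplex product, so \<^typ>\<open>bicomplex\<close> is not made an instance of \<^class>\<open>real_normed_algebra\<close>.\<close>

instantiation bicomplex :: real_normed_vector
begin

definition "r *\<^sub>R Z = BiComplex (r *\<^sub>R fst_part Z) (r *\<^sub>R snd_part Z)"
definition "norm Z = norm (fst_part Z, snd_part Z)"
definition "sgn Z = inverse (norm Z) *\<^sub>R Z" for Z :: bicomplex
definition "dist Z W = norm (Z - W)" for Z W :: bicomplex
definition "uniformity = (INF e\<in>{0<..}. principal {(Z, W :: bicomplex). dist Z W < e})"
definition "open U \<longleftrightarrow> (\<forall>Z\<in>U. eventually (\<lambda>(Z', W). Z' = Z \<longrightarrow> W \<in> U) uniformity)"
  for U :: "bicomplex set"

instance
proof
  fix r s :: real and Z W :: bicomplex and U :: "bicomplex set"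
  show "dist Z W = norm (Z - W)" by (rule dist_bicomplex_def)
  show "sgn Z = inverse (norm Z) *\<^sub>R Z" by (rule sgn_bicomplex_def)
  show "uniformity = (INF e\<in>{0<..}. principal {(Z, W :: bicomplex). dist Z W < e})"
    by (rule uniformity_bicomplex_def)
  show "open U \<longleftrightarrow> (\<forall>Z\<in>U. eventually (\<lambda>(Z', W). Z' = Z \<longrightarrow> W \<in> U) uniformity)"
    by (rule open_bicomplex_def)
  show "norm Z = 0 \<longleftrightarrow> Z = 0"
    by (cases Z) (simp add: norm_bicomplex_def zero_bicomplex_def zero_prod_def)
  show "norm (Z + W) \<le> norm Z + norm W"
    using norm_triangle_ineq[of "(fst_part Z, snd_part Z)" "(fst_part W, snd_part W)"]
    by (simp add: norm_bicomplex_def plus_bicomplex_def)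
  show "norm (r *\<^sub>R Z) = \<bar>r\<bar> * norm Z"
    using norm_scaleR[of r "(fst_part Z, snd_part Z)"]
    by (simp add: norm_bicomplex_def scaleR_bicomplex_def del: norm_scaleR)
qed (simp_all add: scaleR_bicomplex_def plus_bicomplex_def algebra_simps)

end

instance bicomplex :: real_algebra_1
  by intro_classes
    (simp_all add: scaleR_bicomplex_def times_bicomplex_def algebra_simps zero_bicomplex_def
      one_bicomplex_def)

definition bc_of_complex :: "complex \<Rightarrow> bicomplex" where
  "bc_of_complex z = BiComplex z 0"

definition bc_j :: bicomplex where
  "bc_j = BiComplex 0 1"

definition bc_e :: bicomplex where
  "bc_e = (1 / 2) *\<^sub>R (1 + bc_of_complex \<i> * bc_j)"

definition bc_e_dagger :: bicomplex where
  "bc_e_dagger = (1 / 2) *\<^sub>R (1 - bc_of_complex \<i> * bc_j)"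

definition bc_units :: "bicomplex set" where
  "bc_units = {bc_of_complex z1 * bc_e + bc_of_complex z2 * bc_e_dagger | z1 z2. z1 \<noteq> 0 \<and> z2 \<noteq> 0}"

definition bc_singular :: "bicomplex set" where
  "bc_singular = UNIV - bc_units"

definition bc_tilde :: "bicomplex \<Rightarrow> bicomplex" where
  "bc_tilde Z = BiComplex (cnj (fst_part Z)) (- cnj (snd_part Z))"

definition bc_hat :: "bicomplex \<Rightarrow> bicomplex" where
  "bc_hat Z = BiComplex (fst_part Z) (- snd_part Z)"

definition bc_bar :: "bicomplex \<Rightarrow> bicomplex" where
  "bc_bar Z = BiComplex (cnj (fst_part Z)) (cnj (snd_part Z))"

text \<open>\<open>e\<^bsup>\<^bold>j\<Theta>\<^esup> = cos \<Theta> + \<^bold>j sin \<Theta>\<close>; for \<open>\<Theta> \<in> \<complex>\<close> these are exactly the points \<open>z + \<^bold>j w\<close> of the complex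
  unit circle \<open>z\<^sup>2 + w\<^sup>2 = 1\<close>.\<close>

definition bc_expj :: "complex \<Rightarrow> bicomplex" where
  "bc_expj \<Theta> = BiComplex (cos \<Theta>) (sin \<Theta>)"


section \<open>Polar weighted homogeneous bicomplex mixed polynomials\<close>

definition bc_mixed_polynomial :: "(bicomplex ^ 'n \<Rightarrow> bicomplex) \<Rightarrow> bool" where
  "bc_mixed_polynomial F \<longleftrightarrow>
     (\<exists>(N :: nat) (\<mu> :: nat \<Rightarrow> bicomplex) (a :: nat \<Rightarrow> 'n \<Rightarrow> nat) b c d.
        (\<forall>k<N. \<mu> k \<noteq> 0) \<and>
        (\<forall>Z. F Z = (\<Sum>k<N. \<mu> k * (\<Prod>i\<in>UNIV. (Z $ i) ^ a k i * bc_tilde (Z $ i) ^ b k i *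
                                          bc_hat (Z $ i) ^ c k i * bc_bar (Z $ i) ^ d k i))))"

text \<open>The action of \<open>s e\<^bsup>\<^bold>i\<theta>\<^esup> e\<^bsup>\<^bold>j\<Theta>\<^esup>\<close> with radial weights \<open>t\<close>, polar weights \<open>p\<close> and complex polar
  weights \<open>u\<close>. The parameters are \<open>(s, \<theta>, \<Theta>)\<close> rather than their product, because a bicomplex number
  has more than one such decomposition (\<open>-1 = e\<^bsup>\<^bold>i\<pi>\<^esup> = e\<^bsup>\<^bold>j\<pi>\<^esup>\<close>), on which the action may depend.
  As the three conjugations are ring homomorphisms, the action on the conjugate variables is
  determined by the one on \<open>Z\<close>, as the lemmas below record.\<close>

definition bc_polar_action ::
  "('n \<Rightarrow> nat) \<Rightarrow> ('n \<Rightarrow> nat) \<Rightarrow> ('n \<Rightarrow> nat) \<Rightarrow> real \<Rightarrow> real \<Rightarrow> complex \<Rightarrow> bicomplex ^ 'n \<Rightarrow> bicomplex ^ 'n"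
  where
  "bc_polar_action t p u s \<theta> \<Theta> Z =
     (\<chi> i. of_real (s ^ t i) * bc_of_complex (exp (\<i> * of_nat (p i) * of_real \<theta>)) *
           bc_expj (of_nat (u i) * \<Theta>) * Z $ i)"

lemma bc_hat_polar_action:
  "bc_hat (bc_polar_action t p u s \<theta> \<Theta> Z $ i) =
     of_real (s ^ t i) * bc_of_complex (exp (\<i> * of_nat (p i) * of_real \<theta>)) *
     bc_expj (- (of_nat (u i) * \<Theta>)) * bc_hat (Z $ i)"
  by (simp add: bc_polar_action_def bc_hat_def bc_expj_def bc_of_complex_def times_bicomplex_def
      of_real_def scaleR_bicomplex_def one_bicomplex_def algebra_simps)

lemma bc_tilde_polar_action:
  "bc_tilde (bc_polar_action t p u s \<theta> \<Theta> Z $ i) =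
     of_real (s ^ t i) * bc_of_complex (exp (- (\<i> * of_nat (p i) * of_real \<theta>))) *
     bc_expj (- (of_nat (u i) * cnj \<Theta>)) * bc_tilde (Z $ i)"
  by (simp add: bc_polar_action_def bc_tilde_def bc_expj_def bc_of_complex_def times_bicomplex_def
      of_real_def scaleR_bicomplex_def one_bicomplex_def algebra_simps exp_cnj cnj_cos cnj_sin)

lemma bc_bar_polar_action:
  "bc_bar (bc_polar_action t p u s \<theta> \<Theta> Z $ i) =
     of_real (s ^ t i) * bc_of_complex (exp (- (\<i> * of_nat (p i) * of_real \<theta>))) *
     bc_expj (of_nat (u i) * cnj \<Theta>) * bc_bar (Z $ i)"
  by (simp add: bc_polar_action_def bc_bar_def bc_expj_def bc_of_complex_def times_bicomplex_def
      of_real_def scaleR_bicomplex_def one_bicomplex_def algebra_simps exp_cnj cnj_cos cnj_sin)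

text \<open>The degrees may satisfy \<open>d = d'\<close>. Then \<open>F\<close> need not be open into the invertible numbers: for
  \<open>n = 1\<close>, the polynomial \<open>Z\<^sup>2 * bc_hat Z * bc_bar Z\<close> has \<open>a = 4\<close>, \<open>c = 2\<close>, \<open>d = d' = 1\<close>, and its values
  \<open>z\<^sub>1 e + z\<^sub>2 e\<^sup>\<dagger>\<close> all satisfy \<open>\<bar>z\<^sub>1\<bar> = \<bar>z\<^sub>2\<bar>\<close>. Fibration results therefore need \<open>d \<noteq> d'\<close> in addition.\<close>

definition bc_polar_weighted_homogeneous ::
  "('n \<Rightarrow> nat) \<Rightarrow> ('n \<Rightarrow> nat) \<Rightarrow> ('n \<Rightarrow> nat) \<Rightarrow> nat \<Rightarrow> nat \<Rightarrow> nat \<Rightarrow> nat \<Rightarrow>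
   (bicomplex ^ 'n \<Rightarrow> bicomplex) \<Rightarrow> bool"
  where
  "bc_polar_weighted_homogeneous t p u a c d d' F \<longleftrightarrow>
     bc_mixed_polynomial F \<and>
     (\<forall>i. t i > 0 \<and> p i > 0 \<and> u i > 0) \<and>
     Gcd (range t) = 1 \<and> Gcd (range p) = 1 \<and> Gcd (range u) = 1 \<and>
     a > 0 \<and> c > 0 \<and> (d > 0 \<or> d' > 0) \<and>
     (\<forall>s>0. \<forall>\<theta> \<Theta> Z.
        F (bc_polar_action t p u s \<theta> \<Theta> Z) =
          of_real (s ^ a) * bc_of_complex (exp (\<i> * of_nat c * of_real \<theta>)) *
          bc_expj (of_nat d * \<Theta>) * bc_expj (of_nat d' * cnj \<Theta>) * F Z)"


section \<open>Locally trivial fibrations\<close>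

text \<open>\<open>f : E \<rightarrow> B\<close> is locally a projection \<open>U \<times> T \<rightarrow> U\<close>, up to homeomorphism, with one typical fibre \<open>T\<close>
  for all of \<open>B\<close>. For nonempty \<open>B\<close> the fibre embeds into \<open>E\<close>, so it is no restriction to take
  \<open>T\<close> in the type of \<open>E\<close>. The fibre may be empty, but then
  so is \<open>E\<close>; otherwise \<open>f\<close> is onto \<open>B\<close>.\<close>

definition locally_trivial_fibration ::
  "'a::topological_space set \<Rightarrow> 'b::topological_space set \<Rightarrow> ('a \<Rightarrow> 'b) \<Rightarrow> bool" where
  "locally_trivial_fibration E B f \<longleftrightarrow>
     f ` E \<subseteq> B \<and> continuous_on E f \<and>
     (\<exists>T :: 'a set. \<forall>b\<in>B. \<exists>U. b \<in> U \<and> openin (top_of_set B) U \<and>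
        (\<exists>h g. homeomorphism (E \<inter> f -` U) (U \<times> T) h g \<and>
               (\<forall>x \<in> E \<inter> f -` U. fst (h x) = f x)))"

end

theory Submission
  imports Defs
begin

text \<open>
  The action moves the fibres of \<open>F\<close> onto one another: by homogeneity, the element with parameters
  \<open>(s, \<theta>, \<Theta>)\<close> maps the fibre over \<open>1\<close> bijectively to the fibre over
  \<open>s\<^sup>a e\<^bsup>\<^bold>ic\<theta>\<^esup> e\<^bsup>\<^bold>j(d\<Theta> + d' cnj \<Theta>)\<^esup>\<close>. So it is enough to solve, locally and continuously
  in \<open>Y \<in> bc_units\<close>, the equation that this factor equals \<open>Y\<close>
  (lemma \<open>local_polar_parameters\<close>); acting with the solution then identifies \<open>U \<times> F -` {1}\<close> with
  \<open>F -` U\<close> (lemma \<open>locally_trivial_fibration_by_fibre_transport\<close>).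

  The equation decouples in the idempotent coordinates \<open>(z\<^sub>1, z\<^sub>2)\<close> of \<open>Y = z\<^sub>1 e + z\<^sub>2 e\<^sup>\<dagger>\<close>, in which the
  product is componentwise: \<open>e\<^sup>w e\<^bsup>\<^bold>j\<Omega>\<^esup>\<close> with complex \<open>w\<close> and \<open>\<Omega>\<close> has the coordinates
  \<open>e\<^bsup>w - \<^bold>i\<Omega>\<^esup>\<close> and \<open>e\<^bsup>w + \<^bold>i\<Omega>\<^esup>\<close>, so \<open>w\<close> and \<open>\<Omega>\<close> are half the sum and a multiple of the difference of
  local branches of \<open>log z\<^sub>1\<close> and \<open>log z\<^sub>2\<close>. From \<open>w = a log s + \<^bold>ic\<theta>\<close> one reads off \<open>s\<close> and \<open>\<theta>\<close>,
  as \<open>a, c > 0\<close>. The real linear map \<open>\<Theta> \<mapsto> d\<Theta> + d' cnj \<Theta>\<close> multiplies the real part by \<open>d + d'\<close> and the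
  imaginary part by \<open>d - d'\<close>, so it is invertible exactly because \<open>d \<noteq> d'\<close>.
\<close>

section \<open>Continuity of the bicomplex operations\<close>

lemmas bicomplex_defs = zero_bicomplex_def one_bicomplex_def plus_bicomplex_def
  minus_bicomplex_def uminus_bicomplex_def times_bicomplex_def scaleR_bicomplex_def

lemma of_real_bicomplex: "of_real r = BiComplex (of_real r) 0"
  by (simp add: of_real_def[where ?'a = bicomplex] bicomplex_defs scaleR_conv_of_real)

lemma bounded_linear_fst_part: "bounded_linear fst_part"
  by (rule bounded_linear_intro[where K = 1])
    (auto simp: bicomplex_defs norm_bicomplex_def norm_Pair)

lemma bounded_linear_snd_part: "bounded_linear snd_part"
  by (rule bounded_linear_intro[where K = 1])
    (auto simp: bicomplex_defs norm_bicomplex_def norm_Pair)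

lemma bounded_linear_BiComplex_fst: "bounded_linear (\<lambda>z. BiComplex z 0)"
  by (rule bounded_linear_intro[where K = 1])
    (auto simp: bicomplex_defs norm_bicomplex_def norm_Pair)

lemma bounded_linear_BiComplex_snd: "bounded_linear (\<lambda>z. BiComplex 0 z)"
  by (rule bounded_linear_intro[where K = 1])
    (auto simp: bicomplex_defs norm_bicomplex_def norm_Pair)

lemmas continuous_on_fst_part [continuous_intros] =
  bounded_linear.continuous_on[OF bounded_linear_fst_part]
lemmas continuous_on_snd_part [continuous_intros] =
  bounded_linear.continuous_on[OF bounded_linear_snd_part]

lemma continuous_on_BiComplex [continuous_intros]:
  assumes "continuous_on S f" "continuous_on S g"
  shows "continuous_on S (\<lambda>x. BiComplex (f x) (g x))"
proof -
  have "continuous_on S (\<lambda>x. BiComplex (f x) 0 + BiComplex 0 (g x))"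
    by (intro continuous_on_add bounded_linear.continuous_on[OF bounded_linear_BiComplex_fst]
        bounded_linear.continuous_on[OF bounded_linear_BiComplex_snd] assms)
  then show ?thesis by (simp add: plus_bicomplex_def)
qed

text \<open>The Euclidean norm is not submultiplicative for the bicomplex product, so the continuity of
  products is read off from the complex components.\<close>

lemma continuous_on_bicomplex_mult [continuous_intros]:
  fixes f g :: "'a::topological_space \<Rightarrow> bicomplex"
  assumes "continuous_on S f" "continuous_on S g"
  shows "continuous_on S (\<lambda>x. f x * g x)"
  unfolding times_bicomplex_def by (intro continuous_intros assms)

lemma continuous_on_bicomplex_power [continuous_intros]:
  fixes f :: "'a::topological_space \<Rightarrow> bicomplex"
  assumes "continuous_on S f"
  shows "continuous_on S (\<lambda>x. f x ^ n)"
  by (induction n) (auto intro!: continuous_intros assms)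

lemma continuous_on_bicomplex_prod [continuous_intros]:
  fixes f :: "'i \<Rightarrow> 'a::topological_space \<Rightarrow> bicomplex"
  assumes "\<And>i. i \<in> I \<Longrightarrow> continuous_on S (f i)"
  shows "continuous_on S (\<lambda>x. \<Prod>i\<in>I. f i x)"
  using assms by (induction I rule: infinite_finite_induct) (auto intro!: continuous_intros)

lemma continuous_on_bc_mixed_polynomial:
  assumes "bc_mixed_polynomial F"
  shows "continuous_on S F"
proof -
  from assms obtain N :: nat and \<mu> a b c d where
    F: "F Z = (\<Sum>k<N. \<mu> k * (\<Prod>i\<in>UNIV. (Z $ i) ^ a k i * bc_tilde (Z $ i) ^ b k i *
                                       bc_hat (Z $ i) ^ c k i * bc_bar (Z $ i) ^ d k i))" for Z
    unfolding bc_mixed_polynomial_def by blast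
  show ?thesis
    unfolding F[abs_def] bc_tilde_def bc_hat_def bc_bar_def by (intro continuous_intros)
qed

lemma continuous_on_bc_polar_action:
  fixes S :: "'a::t2_space set"
  assumes "continuous_on S s" "continuous_on S \<theta>" "continuous_on S \<Theta>" "continuous_on S Z"
  shows "continuous_on S (\<lambda>x. bc_polar_action t p u (s x) (\<theta> x) (\<Theta> x) (Z x))"
  unfolding bc_polar_action_def of_real_bicomplex bc_of_complex_def bc_expj_def
  by (intro continuous_intros assms)

section \<open>Idempotent coordinates\<close>

definition idem_fst :: "bicomplex \<Rightarrow> complex" where
  "idem_fst Z = fst_part Z - \<i> * snd_part Z"

definition idem_snd :: "bicomplex \<Rightarrow> complex" where
  "idem_snd Z = fst_part Z + \<i> * snd_part Z"

lemma idem_mult: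
  "idem_fst (Z * W) = idem_fst Z * idem_fst W" "idem_snd (Z * W) = idem_snd Z * idem_snd W"
  by (simp_all add: idem_fst_def idem_snd_def times_bicomplex_def algebra_simps)

lemma idem_one: "idem_fst 1 = 1" "idem_snd 1 = 1"
  by (simp_all add: idem_fst_def idem_snd_def one_bicomplex_def)

lemma idem_eqI:
  assumes "idem_fst Z = idem_fst W" "idem_snd Z = idem_snd W"
  shows "Z = W"
proof (rule bicomplex_eqI)
  have "2 * fst_part Z = 2 * fst_part W"
    using arg_cong2[OF assms, of "(+)"] by (simp add: idem_fst_def idem_snd_def)
  then show "fst_part Z = fst_part W" by simp
  then show "snd_part Z = snd_part W" using assms(2) by (simp add: idem_snd_def)
qed

lemma idem_combination:
  "idem_fst (bc_of_complex z1 * bc_e + bc_of_complex z2 * bc_e_dagger) = z1"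
  "idem_snd (bc_of_complex z1 * bc_e + bc_of_complex z2 * bc_e_dagger) = z2"
  by (simp_all add: idem_fst_def idem_snd_def bc_of_complex_def bc_e_def bc_e_dagger_def bc_j_def
      bicomplex_defs scaleR_conv_of_real field_simps)

lemma bc_units_iff: "Y \<in> bc_units \<longleftrightarrow> idem_fst Y \<noteq> 0 \<and> idem_snd Y \<noteq> 0"
proof
  assume "Y \<in> bc_units"
  then show "idem_fst Y \<noteq> 0 \<and> idem_snd Y \<noteq> 0"
    unfolding bc_units_def by (auto simp: idem_combination)
next
  assume "idem_fst Y \<noteq> 0 \<and> idem_snd Y \<noteq> 0"
  moreover have "Y = bc_of_complex (idem_fst Y) * bc_e + bc_of_complex (idem_snd Y) * bc_e_dagger"
    by (rule idem_eqI) (simp_all add: idem_combination)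
  ultimately show "Y \<in> bc_units"
    unfolding bc_units_def by blast
qed

lemma bc_units_cancel:
  assumes "Y \<in> bc_units" "Y * Z = Y"
  shows "Z = 1"
  using assms idem_mult[of Y Z] by (intro idem_eqI) (auto simp: bc_units_iff idem_one)

lemma continuous_on_idem_fst [continuous_intros]:
  "continuous_on S f \<Longrightarrow> continuous_on S (\<lambda>x. idem_fst (f x))"
  unfolding idem_fst_def by (intro continuous_intros)

lemma continuous_on_idem_snd [continuous_intros]:
  "continuous_on S f \<Longrightarrow> continuous_on S (\<lambda>x. idem_snd (f x))"
  unfolding idem_snd_def by (intro continuous_intros)

lemma idem_bc_of_complex: "idem_fst (bc_of_complex z) = z" "idem_snd (bc_of_complex z) = z"
  by (simp_all add: idem_fst_def idem_snd_def bc_of_complex_def)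

lemma idem_expj: "idem_fst (bc_expj \<Omega>) = exp (- (\<i> * \<Omega>))" "idem_snd (bc_expj \<Omega>) = exp (\<i> * \<Omega>)"
  using exp_Euler[of \<Omega>] exp_Euler[of "- \<Omega>"]
  by (simp_all add: idem_fst_def idem_snd_def bc_expj_def)

lemma bc_expj_add: "bc_expj (\<Theta> + \<Omega>) = bc_expj \<Theta> * bc_expj \<Omega>"
  by (rule idem_eqI) (simp_all add: idem_mult idem_expj algebra_simps flip: exp_add)

section \<open>Solving locally for the polar parameters\<close>

text \<open>The branches of the logarithm are translates of the principal one by a constant, which lets
  them be centred at the given point \<open>b\<close>.\<close>

lemma local_logarithm:
  assumes "b \<noteq> 0" "z / b \<notin> \<real>\<^sub>\<le>\<^sub>0"
  shows "exp (Ln (z / b) + Ln b) = z"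
proof -
  have "z / b \<noteq> 0" using assms(2) by auto
  then show ?thesis using assms(1) by (simp add: exp_add)
qed

text \<open>Taking local logarithms \<open>l1\<close> and \<open>l2\<close> of the idempotent coordinates turns the equation into
  \<open>w - \<i>\<Omega> = l1\<close> and \<open>w + \<i>\<Omega> = l2\<close>, where \<open>w = a ln s + \<i>c\<theta>\<close> and \<open>\<Omega> = d\<Theta> + d' cnj \<Theta>\<close>. Solving the
  last equation for \<open>\<Theta>\<close> divides \<open>Im \<Omega>\<close> by \<open>d - d'\<close>, hence the hypothesis \<open>d \<noteq> d'\<close>.\<close>

lemma local_polar_parameters:
  assumes "a > 0" "c > 0" "d \<noteq> d'" and b: "b \<in> bc_units"
  obtains U s \<theta> \<Theta> where
    "b \<in> U" "openin (top_of_set bc_units) U"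
    "continuous_on U s" "continuous_on U \<theta>" "continuous_on U \<Theta>"
    "\<And>Y. Y \<in> U \<Longrightarrow> s Y > 0"
    "\<And>Y. Y \<in> U \<Longrightarrow> of_real (s Y ^ a) * bc_of_complex (exp (\<i> * of_nat c * of_real (\<theta> Y))) *
        bc_expj (of_nat d * \<Theta> Y) * bc_expj (of_nat d' * cnj (\<Theta> Y)) = Y"
proof -
  define b1 b2 where "b1 = idem_fst b" and "b2 = idem_snd b"
  have nz: "b1 \<noteq> 0" "b2 \<noteq> 0" using b by (auto simp: b1_def b2_def bc_units_iff)
  define U where "U = (bc_units \<inter> (\<lambda>Y. idem_fst Y / b1) -` (- \<real>\<^sub>\<le>\<^sub>0)) \<inter>
    (bc_units \<inter> (\<lambda>Y. idem_snd Y / b2) -` (- \<real>\<^sub>\<le>\<^sub>0))"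
  define l1 l2 where "l1 = (\<lambda>Y. Ln (idem_fst Y / b1) + Ln b1)"
    and "l2 = (\<lambda>Y. Ln (idem_snd Y / b2) + Ln b2)"
  define w \<Omega> where "w = (\<lambda>Y. (l1 Y + l2 Y) / 2)" and "\<Omega> = (\<lambda>Y. (l2 Y - l1 Y) / (2 * \<i>))"
  define s where "s = (\<lambda>Y. exp (Re (w Y) / real a))"
  define \<theta> where "\<theta> = (\<lambda>Y. Im (w Y) / real c)"
  define \<Theta> where "\<Theta> = (\<lambda>Y. Complex (Re (\<Omega> Y) / (real d + real d')) (Im (\<Omega> Y) / (real d - real d')))"
  have l_cont: "continuous_on U l1" "continuous_on U l2"
    unfolding l1_def l2_def U_def using nz by (auto intro!: continuous_intros)
  have w_cont: "continuous_on U w" "continuous_on U \<Omega>"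
    unfolding w_def \<Omega>_def by (intro continuous_intros l_cont; simp)+
  have complex_dd: "complex_of_nat d + of_nat d' \<noteq> 0"
    unfolding of_nat_add[symmetric] of_nat_eq_0_iff using assms(3) by linarith
  show thesis
  proof
    show "b \<in> U" using b nz by (simp add: U_def b1_def b2_def)
    show "openin (top_of_set bc_units) U"
      unfolding U_def using nz
      by (intro openin_Int continuous_openin_preimage_gen)
        (auto intro!: continuous_intros simp: open_Compl)
    show "continuous_on U s" "continuous_on U \<theta>" "continuous_on U \<Theta>"
      unfolding s_def \<theta>_def \<Theta>_def Complex_eq using assms complex_dd
      by (auto intro!: continuous_intros w_cont)
    fix Y assume Y: "Y \<in> U"
    show "s Y > 0" by (simp add: s_def)
    have "exp (w Y) = exp (of_real (Re (w Y))) * exp (\<i> * of_real (Im (w Y)))"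
      by (metis complex_eq exp_add)
    moreover have "of_real (s Y ^ a) = exp (complex_of_real (Re (w Y)))"
      using assms by (simp add: s_def exp_of_real flip: exp_of_nat_mult)
    moreover have "of_nat c * complex_of_real (\<theta> Y) = of_real (Im (w Y))"
      using assms by (simp add: \<theta>_def)
    ultimately have exp_w: "of_real (s Y ^ a) * exp (\<i> * of_nat c * of_real (\<theta> Y)) = exp (w Y)"
      by (simp add: mult.assoc)
    have "real d + real d' \<noteq> 0" "real d - real d' \<noteq> 0" using assms by auto
    then have "of_nat d * \<Theta> Y + of_nat d' * cnj (\<Theta> Y) = \<Omega> Y"
      by (simp add: complex_eq_iff \<Theta>_def
          flip: add_divide_distrib diff_divide_distrib distrib_right left_diff_distrib)
    then have expj_\<Omega>: "bc_expj (of_nat d * \<Theta> Y) * bc_expj (of_nat d' * cnj (\<Theta> Y)) = bc_expj (\<Omega> Y)"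
      by (simp flip: bc_expj_add)
    have "exp (w Y) * exp (- (\<i> * \<Omega> Y)) = exp (l1 Y)" "exp (w Y) * exp (\<i> * \<Omega> Y) = exp (l2 Y)"
      unfolding exp_add[symmetric] by (simp_all add: w_def \<Omega>_def field_simps)
    moreover have "exp (l1 Y) = idem_fst Y" "exp (l2 Y) = idem_snd Y"
      using Y nz unfolding l1_def l2_def U_def by (auto intro!: local_logarithm)
    ultimately have "bc_of_complex (exp (w Y)) * bc_expj (\<Omega> Y) = Y"
      by (intro idem_eqI) (simp_all add: idem_mult idem_expj idem_bc_of_complex)
    moreover have "of_real (s Y ^ a) * bc_of_complex (exp (\<i> * of_nat c * of_real (\<theta> Y))) =
        bc_of_complex (exp (w Y))"
      unfolding exp_w[symmetric]
      by (simp add: of_real_bicomplex bc_of_complex_def times_bicomplex_def)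
    ultimately show "of_real (s Y ^ a) * bc_of_complex (exp (\<i> * of_nat c * of_real (\<theta> Y))) *
        bc_expj (of_nat d * \<Theta> Y) * bc_expj (of_nat d' * cnj (\<Theta> Y)) = Y"
      using expj_\<Omega> by (simp add: mult.assoc)
  qed
qed

section \<open>Transporting fibres\<close>

lemma bc_polar_action_cancel:
  assumes "s * s' = 1"
  shows "bc_polar_action t p u s \<theta> \<Theta> (bc_polar_action t p u s' (- \<theta>) (- \<Theta>) Z) = Z"
proof -
  have "(of_real (s ^ t i) * bc_of_complex (exp (\<i> * of_nat (p i) * of_real \<theta>)) *
      bc_expj (of_nat (u i) * \<Theta>)) * (of_real (s' ^ t i) *
      bc_of_complex (exp (\<i> * of_nat (p i) * of_real (- \<theta>))) * bc_expj (of_nat (u i) * (- \<Theta>))) = 1"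
    (is "(?r * ?z * ?j) * (?r' * ?z' * ?j') = 1") for i
  proof -
    have "?r * ?r' = 1"
      using assms by (simp flip: of_real_mult power_mult_distrib)
    moreover have "?z * ?z' = 1"
      by (simp add: bc_of_complex_def times_bicomplex_def one_bicomplex_def flip: exp_add)
    moreover have "?j * ?j' = 1"
      by (simp flip: bc_expj_add) (simp add: bc_expj_def one_bicomplex_def)
    moreover have "(?r * ?z * ?j) * (?r' * ?z' * ?j') = (?r * ?r') * (?z * ?z') * (?j * ?j')"
      by (simp only: mult_ac)
    ultimately show ?thesis by (simp only: mult_1_right)
  qed
  then show ?thesis
    by (simp add: bc_polar_action_def vec_eq_iff flip: mult.assoc)
qed

text \<open>A family of mutually inverse bijections \<open>\<phi> y\<close> and \<open>\<psi> y\<close> between \<open>T\<close> and the fibres over \<open>y \<in> U\<close>,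
  continuous as \<open>y\<close> varies, is the same as a trivialization over \<open>U\<close>.\<close>

lemma locally_trivial_fibration_by_fibre_transport:
  fixes f :: "'a::topological_space \<Rightarrow> 'b::topological_space" and T :: "'a set"
  assumes "f ` E \<subseteq> B" "continuous_on E f"
    and "\<And>b. b \<in> B \<Longrightarrow> \<exists>U \<phi> \<psi>. b \<in> U \<and> openin (top_of_set B) U \<and>
      (\<forall>y\<in>U. \<forall>x\<in>T. \<phi> y x \<in> E \<and> f (\<phi> y x) = y \<and> \<psi> y (\<phi> y x) = x) \<and>
      (\<forall>x\<in>E. f x \<in> U \<longrightarrow> \<psi> (f x) x \<in> T \<and> \<phi> (f x) (\<psi> (f x) x) = x) \<and>
      continuous_on (U \<times> T) (\<lambda>q. \<phi> (fst q) (snd q)) \<and>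
      continuous_on (E \<inter> f -` U) (\<lambda>x. \<psi> (f x) x)"
  shows "locally_trivial_fibration E B f"
  unfolding locally_trivial_fibration_def
proof (intro conjI assms(1,2) exI[of _ T] ballI)
  fix b assume "b \<in> B"
  from assms(3)[OF this] obtain U \<phi> \<psi> where U: "b \<in> U" "openin (top_of_set B) U"
    and \<phi>: "\<forall>y\<in>U. \<forall>x\<in>T. \<phi> y x \<in> E \<and> f (\<phi> y x) = y \<and> \<psi> y (\<phi> y x) = x"
    and \<psi>: "\<forall>x\<in>E. f x \<in> U \<longrightarrow> \<psi> (f x) x \<in> T \<and> \<phi> (f x) (\<psi> (f x) x) = x"
    and cont: "continuous_on (U \<times> T) (\<lambda>q. \<phi> (fst q) (snd q))"
      "continuous_on (E \<inter> f -` U) (\<lambda>x. \<psi> (f x) x)"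
    by (elim exE conjE) (rule that)
  have "continuous_on (E \<inter> f -` U) f"
    using assms(2) by (rule continuous_on_subset) auto
  then have "homeomorphism (E \<inter> f -` U) (U \<times> T) (\<lambda>x. (f x, \<psi> (f x) x)) (\<lambda>q. \<phi> (fst q) (snd q))"
    using \<phi> \<psi> cont by (intro homeomorphismI) (auto intro!: continuous_on_Pair)
  then show "\<exists>U. b \<in> U \<and> openin (top_of_set B) U \<and>
      (\<exists>h g. homeomorphism (E \<inter> f -` U) (U \<times> T) h g \<and> (\<forall>x\<in>E \<inter> f -` U. fst (h x) = f x))"
    using U by (metis fst_conv)
qed

theorem proposition5p3:
  fixes F :: "bicomplex ^ 'n \<Rightarrow> bicomplex"
    and t p u :: "'n \<Rightarrow> nat" and a c d d' :: nat
  assumes "bc_polar_weighted_homogeneous t p u a c d d' F"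
    and "d \<noteq> d'"
  shows "locally_trivial_fibration (UNIV - F -` bc_singular) bc_units F"
proof (rule locally_trivial_fibration_by_fibre_transport[where T = "F -` {1}"])
  have hom: "F (bc_polar_action t p u s \<theta> \<Theta> Z) =
      of_real (s ^ a) * bc_of_complex (exp (\<i> * of_nat c * of_real \<theta>)) *
      bc_expj (of_nat d * \<Theta>) * bc_expj (of_nat d' * cnj \<Theta>) * F Z" if "s > 0" for s \<theta> \<Theta> Z
    using assms(1) that unfolding bc_polar_weighted_homogeneous_def by blast
  have ac: "a > 0" "c > 0" and "bc_mixed_polynomial F"
    using assms(1) by (auto simp: bc_polar_weighted_homogeneous_def)
  then have F_cont: "continuous_on S F" for S
    by (intro continuous_on_bc_mixed_polynomial)
  then show "continuous_on (UNIV - F -` bc_singular) F" .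
  have E: "UNIV - F -` bc_singular = F -` bc_units" by (auto simp: bc_singular_def)
  then show "F ` (UNIV - F -` bc_singular) \<subseteq> bc_units" by auto
  fix b assume "b \<in> bc_units"
  with ac assms(2) obtain U s \<theta> \<Theta> where U: "b \<in> U" "openin (top_of_set bc_units) U"
    and cont: "continuous_on U s" "continuous_on U \<theta>" "continuous_on U \<Theta>"
    and s: "\<And>Y. Y \<in> U \<Longrightarrow> s Y > 0"
    and factor: "\<And>Y. Y \<in> U \<Longrightarrow>
        of_real (s Y ^ a) * bc_of_complex (exp (\<i> * of_nat c * of_real (\<theta> Y))) *
        bc_expj (of_nat d * \<Theta> Y) * bc_expj (of_nat d' * cnj (\<Theta> Y)) = Y"
    by (rule local_polar_parameters) blast
  have U_units: "U \<subseteq> bc_units" using U(2) by (rule openin_imp_subset)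
  define \<phi> where "\<phi> = (\<lambda>Y. bc_polar_action t p u (s Y) (\<theta> Y) (\<Theta> Y))"
  define \<psi> where "\<psi> = (\<lambda>Y. bc_polar_action t p u (inverse (s Y)) (- \<theta> Y) (- \<Theta> Y))"
  have F_\<phi>: "F (\<phi> Y Z) = Y * F Z" if "Y \<in> U" for Y Z
    using hom[OF s[OF that]] factor[OF that] by (simp add: \<phi>_def)
  have \<phi>_\<psi>: "\<phi> Y (\<psi> Y Z) = Z" if "Y \<in> U" for Y Z
    using s[OF that] unfolding \<phi>_def \<psi>_def by (intro bc_polar_action_cancel) simp
  have \<psi>_\<phi>: "\<psi> Y (\<phi> Y Z) = Z" if "Y \<in> U" for Y Z
    using s[OF that] bc_polar_action_cancel[of "inverse (s Y)" "s Y" t p u "- \<theta> Y" "- \<Theta> Y" Z]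
    unfolding \<phi>_def \<psi>_def by simp
  \<comment> \<open>The factor of the inverse element follows without calculation: \<open>\<phi>\<close> undoes \<open>\<psi>\<close>, and the unit
    \<open>F Z\<close> can be cancelled from \<open>F Z * F (\<psi> (F Z) Z) = F Z\<close>.\<close>
  have F_\<psi>: "F (\<psi> (F Z) Z) = 1" if "F Z \<in> U" for Z
    using F_\<phi>[OF that, of "\<psi> (F Z) Z"] \<phi>_\<psi>[OF that] U_units that
    by (intro bc_units_cancel[of "F Z"]) auto
  show "\<exists>U \<phi> \<psi>. b \<in> U \<and> openin (top_of_set bc_units) U \<and>
      (\<forall>y\<in>U. \<forall>x\<in>F -` {1}. \<phi> y x \<in> UNIV - F -` bc_singular \<and> F (\<phi> y x) = y \<and> \<psi> y (\<phi> y x) = x) \<and>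
      (\<forall>x\<in>UNIV - F -` bc_singular. F x \<in> U \<longrightarrow>
        \<psi> (F x) x \<in> F -` {1} \<and> \<phi> (F x) (\<psi> (F x) x) = x) \<and>
      continuous_on (U \<times> F -` {1}) (\<lambda>q. \<phi> (fst q) (snd q)) \<and>
      continuous_on ((UNIV - F -` bc_singular) \<inter> F -` U) (\<lambda>x. \<psi> (F x) x)"
  proof (intro exI conjI)
    show "\<forall>y\<in>U. \<forall>x\<in>F -` {1}. \<phi> y x \<in> UNIV - F -` bc_singular \<and> F (\<phi> y x) = y \<and> \<psi> y (\<phi> y x) = x"
      unfolding E using F_\<phi> \<psi>_\<phi> U_units by auto
    show "\<forall>x\<in>UNIV - F -` bc_singular. F x \<in> U \<longrightarrow>
        \<psi> (F x) x \<in> F -` {1} \<and> \<phi> (F x) (\<psi> (F x) x) = x"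
      using F_\<psi> \<phi>_\<psi> by simp
    show "continuous_on (U \<times> F -` {1}) (\<lambda>q. \<phi> (fst q) (snd q))"
      unfolding \<phi>_def
      by (intro continuous_on_bc_polar_action continuous_on_snd continuous_on_id;
          rule continuous_on_compose2[OF _ continuous_on_fst[OF continuous_on_id]])
        (use cont in auto)
    have "continuous_on U (\<lambda>Y. inverse (s Y))"
      using cont(1) s by (intro continuous_on_inverse) force+
    with cont show "continuous_on ((UNIV - F -` bc_singular) \<inter> F -` U) (\<lambda>x. \<psi> (F x) x)"
      unfolding \<psi>_def
      by (intro continuous_on_bc_polar_action continuous_on_minus continuous_on_id;
          intro continuous_on_compose2[OF _ F_cont]) auto
  qed (use U in auto)
qed

end
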